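(* Let $R$ be a finite ring. If every nilpotent element of $R$ lies in the center of $R$, then $R$ is commutative.
   Context: An element $x$ of a ring $R$ is nilpotent if $x^n = 0$ for some integer $n \geq 1$. The center of $R$ is the set of elements $c \in R$ such that $cx = xc$ for all $x \in R$. *)

theory Defs
  imports Main
begin

text \<open>
  Rings are not required to have an identity element: the class \<^class>\<open>ring\<close> demands
  neither a unit nor \<open>0 \<noteq> 1\<close>. The library's power operation needs a unit, so positive
  powers are defined here from multiplication alone; the exponent 0 is never used.
\<close>

definition pos_power :: "'a::semigroup_mult \<Rightarrow> nat \<Rightarrow> 'a" where
  "pos_power x n = (((*) x) ^^ (n - 1)) x"

lemma pos_power_1 [simp]: "pos_power x 1 = x"
  by (simp add: pos_power_def)

lemma pos_power_Suc: "n \<ge> 1 \<Longrightarrow> pos_power x (Suc n) = x * pos_power x n"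
  by (cases n) (simp_all add: pos_power_def)

lemma pos_power_eq_power:
  fixes x :: "'a::monoid_mult"
  assumes "n \<ge> 1"
  shows "pos_power x n = x ^ n"
  using assms by (induction n rule: dec_induct) (simp_all add: pos_power_Suc del: One_nat_def)

definition nilpotent :: "'a::ring \<Rightarrow> bool" where
  "nilpotent x \<longleftrightarrow> (\<exists>n\<ge>1. pos_power x n = 0)"

lemma nilpotent_iff_power:
  fixes x :: "'a::ring_1"
  shows "nilpotent x \<longleftrightarrow> (\<exists>n\<ge>1. x ^ n = 0)"
  unfolding nilpotent_def using pos_power_eq_power by metis

definition ring_center :: "'a::ring set" where
  "ring_center = {c. \<forall>x. c * x = x * c}"

end

theory Submission
  imports Defs Complex_Main "HOL-Computational_Algebra.Polynomial"
begin

text \<open>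
  Idempotents are central, and every element differs from its product with an idempotent power of
  itself by a nilpotent, hence central, element. So a nonzero commutator \<open>c\<close> survives
  multiplication by some idempotent \<open>e\<close>; choosing \<open>e\<close> with \<open>e R\<close> minimal makes
  \<open>S = e R\<close> a noncommutative local ring with identity \<open>e\<close>, whose nilpotents form a central
  ideal \<open>N\<close> and whose other elements are units. Witt's proof of Wedderburn's theorem then works
  in \<open>S\<close> itself. With \<open>Z\<close> the centre of \<open>S\<close> and \<open>q = |Z / N|\<close>, Nakayama's lemma yields
  \<open>|N| = q^t\<close>, \<open>|S| = q^(t + n)\<close> and \<open>|C(a)| = q^(t + d)\<close> with \<open>d\<close> dividing \<open>n\<close>. The value
  \<open>P\<close> of the \<open>n\<close>-th cyclotomic polynomial at \<open>q\<close> divides the size \<open>(q^n - 1) / (q^d - 1)\<close> of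
  every noncentral conjugacy class, hence \<open>|S| - |Z| = q^t ((q^n - 1) - (q - 1))\<close>; being coprime
  to \<open>q\<close>, it divides \<open>q - 1\<close>, although \<open>P > q - 1\<close>.
\<close>

subsection \<open>Values of cyclotomic polynomials\<close>

definition int_coeffs :: "complex poly \<Rightarrow> bool" where
  "int_coeffs p \<longleftrightarrow> (\<forall>i. coeff p i \<in> \<int>)"

lemma int_coeffs_mult: "int_coeffs p \<Longrightarrow> int_coeffs q \<Longrightarrow> int_coeffs (p * q)"
  by (auto simp: int_coeffs_def coeff_mult intro!: Ints_sum Ints_mult)

text \<open>Downward induction on the index: the coefficient of \<open>p * q\<close> at
  \<open>degree p + i\<close> is \<open>coeff q i\<close> plus terms that involve only higher
  coefficients of \<open>q\<close>.\<close>

lemma int_coeffs_quotient: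
  assumes monic: "lead_coeff p = 1" and p: "int_coeffs p" and pq: "int_coeffs (p * q)"
  shows "int_coeffs q"
proof -
  have "coeff q i \<in> \<int>" for i
  proof (induction "degree q - i" arbitrary: i rule: less_induct)
    case less
    show ?case
    proof (cases "i > degree q")
      case True
      then show ?thesis by (simp add: coeff_eq_0)
    next
      case False
      let ?d = "degree p"
      have low: "coeff p j * coeff q (?d + i - j) \<in> \<int>" if "j < ?d" for j
      proof (cases "?d + i - j > degree q")
        case True
        then show ?thesis by (simp add: coeff_eq_0)
      next
        case nle: False
        with False that have "degree q - (?d + i - j) < degree q - i" by linarith
        from less[OF this] p show ?thesis by (auto simp: int_coeffs_def)
      qed
      have "coeff (p * q) (?d + i) = (\<Sum>j\<le>?d + i. coeff p j * coeff q (?d + i - j))"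
        by (simp add: coeff_mult)
      also have "\<dots> = (\<Sum>j\<le>?d. coeff p j * coeff q (?d + i - j))"
        by (rule sum.mono_neutral_right) (auto simp: coeff_eq_0)
      also have "\<dots> = (\<Sum>j<?d. coeff p j * coeff q (?d + i - j)) + coeff q i"
        using monic by (simp flip: lessThan_Suc_atMost)
      finally have "coeff q i = coeff (p * q) (?d + i) - (\<Sum>j<?d. coeff p j * coeff q (?d + i - j))"
        by simp
      moreover have "\<dots> \<in> \<int>"
        using pq low by (auto simp: int_coeffs_def intro!: Ints_diff Ints_sum)
      ultimately show ?thesis by simp
    qed
  qed
  then show ?thesis by (simp add: int_coeffs_def)
qed

text \<open>On the primitive \<open>n\<close>-th roots of unity this is the \<open>n\<close>-th
  cyclotomic polynomial. Working with root sets turns factorizations into disjoint unions.\<close>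

definition root_poly :: "complex set \<Rightarrow> complex poly" where
  "root_poly A = (\<Prod>z\<in>A. [:- z, 1:])"

lemma lead_coeff_root_poly: "lead_coeff (root_poly A) = 1"
  by (simp add: root_poly_def lead_coeff_prod)

lemma root_poly_Un:
  assumes "finite A" "finite B" "A \<inter> B = {}"
  shows "root_poly (A \<union> B) = root_poly A * root_poly B"
  using assms by (simp add: root_poly_def prod.union_disjoint)

lemma root_poly_Diff:
  assumes "finite A" "B \<subseteq> A"
  shows "root_poly A = root_poly B * root_poly (A - B)"
  using root_poly_Un[of B "A - B"] assms by (metis Diff_disjoint Diff_partition finite_Diff finite_subset)

lemma int_coeffs_root_poly_Diff:
  assumes "finite A" "B \<subseteq> A" "int_coeffs (root_poly A)" "int_coeffs (root_poly B)"
  shows "int_coeffs (root_poly (A - B))"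
  using int_coeffs_quotient[OF lead_coeff_root_poly[of B] assms(4)] assms(3)
  by (simp add: root_poly_Diff[OF assms(1,2)])

lemma degree_root_poly: "finite A \<Longrightarrow> degree (root_poly A) = card A"
  by (simp add: root_poly_def degree_prod_eq_sum_degree)

lemma root_poly_roots_unity:
  assumes "n > 0"
  shows "root_poly {z. z ^ n = 1} = monom 1 n - 1"
proof -
  let ?A = "{z::complex. z ^ n = 1}"
  have fin: "finite ?A" using assms by (simp add: finite_roots_unity)
  have card: "card ?A = n" using assms by (rule card_roots_unity_eq)
  have deg: "degree (monom 1 n - 1 :: complex poly) \<le> n"
    by (intro degree_diff_le) (simp_all add: degree_monom_le)
  show ?thesis
  \<comment> \<open>Both sides are monic of degree \<open>n\<close> and vanish at the
    \<open>n\<close> roots of unity, so their difference has degree below \<open>n\<close> and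
    \<open>n\<close> zeros.\<close>
  proof (rule poly_eqI_degree_lead_coeff[where n = n and A = ?A])
    show "poly (root_poly ?A) z = poly (monom 1 n - 1) z" if "z \<in> ?A" for z
      using that fin by (auto simp: root_poly_def poly_prod poly_monom)
    have "coeff (root_poly ?A) n = 1"
      using lead_coeff_root_poly[of ?A] by (simp add: degree_root_poly fin card)
    then show "coeff (root_poly ?A) n = coeff (monom 1 n - 1) n"
      using assms by simp
  qed (use fin card deg in \<open>auto simp: degree_root_poly\<close>)
qed

section \<open>Primitive roots of unity and cyclotomic polynomials\<close>

definition primitive_roots :: "nat \<Rightarrow> complex set" where
  "primitive_roots n = {z. z ^ n = 1 \<and> (\<forall>m. 0 < m \<and> m < n \<longrightarrow> z ^ m \<noteq> 1)}"

lemma finite_primitive_roots: "n > 0 \<Longrightarrow> finite (primitive_roots n)"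
  using finite_roots_unity[of n] by (rule rev_finite_subset) (auto simp: primitive_roots_def)

text \<open>The order \<open>d\<close> of \<open>z\<close> divides \<open>n\<close>, since otherwise
  \<open>n mod d\<close> would be a smaller positive exponent sending \<open>z\<close> to 1.\<close>

lemma roots_unity_eq_UN_primitive:
  assumes "n > 0"
  shows "{z::complex. z ^ n = 1} = (\<Union>d\<in>{d. d dvd n}. primitive_roots d)"
proof (intro equalityI subsetI)
  fix z :: complex
  assume "z \<in> {z. z ^ n = 1}"
  then have zn: "z ^ n = 1" by simp
  define d where "d = (LEAST m. 0 < m \<and> z ^ m = 1)"
  have d: "0 < d \<and> z ^ d = 1"
    unfolding d_def by (rule LeastI[of _ n]) (use assms zn in auto)
  have least: "z ^ m \<noteq> 1" if "0 < m" "m < d" for m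
    using not_less_Least[of m "\<lambda>m. 0 < m \<and> z ^ m = 1"] that by (auto simp: d_def)
  have "z ^ n = (z ^ d) ^ (n div d) * z ^ (n mod d)"
    by (simp flip: power_mult power_add)
  then have "z ^ (n mod d) = 1" using zn d by simp
  then have "n mod d = 0" using least d by (metis bot_nat_0.not_eq_extremum mod_less_divisor)
  then have "d dvd n" by auto
  then show "z \<in> (\<Union>d\<in>{d. d dvd n}. primitive_roots d)"
    using d least by (auto simp: primitive_roots_def)
next
  fix z assume "z \<in> (\<Union>d\<in>{d. d dvd n}. primitive_roots d)"
  then show "z \<in> {z. z ^ n = 1}" by (auto simp: primitive_roots_def power_mult elim!: dvdE)
qed

lemma primitive_roots_disjoint:
  assumes "m > 0" "n > 0" "m \<noteq> n"
  shows "primitive_roots m \<inter> primitive_roots n = {}"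
proof -
  have "primitive_roots a \<inter> primitive_roots b = {}" if "0 < a" "a < b" for a b
    using that unfolding primitive_roots_def by blast
  from this[of m n] this[of n m] assms show ?thesis by (metis Int_commute linorder_neqE_nat)
qed

lemma int_coeffs_roots_unity: "n > 0 \<Longrightarrow> int_coeffs (root_poly {z. z ^ n = 1})"
  by (simp add: root_poly_roots_unity int_coeffs_def coeff_1)

text \<open>Strong induction: the \<open>n\<close>-th cyclotomic polynomial is X^n - 1 divided by
  the product of those for the proper divisors of \<open>n\<close>, which is monic and
  integral.\<close>

lemma int_coeffs_primitive_roots: "n > 0 \<Longrightarrow> int_coeffs (root_poly (primitive_roots n))"
proof (induction n rule: less_induct)
  case (less n)
  have int_UN: "int_coeffs (root_poly (\<Union>d\<in>D. primitive_roots d))"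
    if "finite D" "\<And>d. d \<in> D \<Longrightarrow> 0 < d \<and> d < n" for D
    using that
  proof (induction D rule: finite_induct)
    case empty
    then show ?case by (auto simp: root_poly_def int_coeffs_def)
  next
    case (insert d D)
    have "primitive_roots d \<inter> (\<Union>d\<in>D. primitive_roots d) = {}"
    proof -
      have "primitive_roots d \<inter> primitive_roots d' = {}" if "d' \<in> D" for d'
        using insert.prems[of d] insert.prems[of d'] insert.hyps that
        by (intro primitive_roots_disjoint) auto
      then show ?thesis by blast
    qed
    moreover have "finite (\<Union>d\<in>D. primitive_roots d)"
      using insert by (auto simp: finite_primitive_roots)
    ultimately show ?case
      using insert less.IH[of d] by (simp add: root_poly_Un finite_primitive_roots int_coeffs_mult)
  qed
  let ?D = "{d. d dvd n \<and> d < n}"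
  have D: "0 < d \<and> d < n" if "d \<in> ?D" for d
    using that less.prems by (auto intro: Nat.gr0I)
  have "{d. d dvd n} = insert n ?D"
    using less.prems by (auto simp: nat_dvd_not_less dvd_imp_le le_neq_implies_less)
  then have eq: "{z. z ^ n = 1} = primitive_roots n \<union> (\<Union>d\<in>?D. primitive_roots d)"
    using roots_unity_eq_UN_primitive[OF less.prems] by simp
  have "primitive_roots n \<inter> primitive_roots d = {}" if "d \<in> ?D" for d
    using D[OF that] less.prems by (intro primitive_roots_disjoint) auto
  then have "primitive_roots n \<inter> (\<Union>d\<in>?D. primitive_roots d) = {}"
    by blast
  then have "primitive_roots n = {z. z ^ n = 1} - (\<Union>d\<in>?D. primitive_roots d)"
    using eq by blast
  moreover have "int_coeffs (root_poly ({z. z ^ n = 1} - (\<Union>d\<in>?D. primitive_roots d)))"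
  proof (intro int_coeffs_root_poly_Diff int_coeffs_roots_unity int_UN)
    show "finite ?D" using less.prems by simp
    show "finite {z::complex. z ^ n = 1}" using less.prems by (simp add: finite_roots_unity)
    show "0 < d \<and> d < n" if "d \<in> ?D" for d using D[OF that] .
  qed (use less.prems eq in auto)
  ultimately show ?case by simp
qed

lemma poly_int_coeffs:
  assumes "int_coeffs p"
  obtains k :: int where "poly p (of_int q) = of_int k"
proof -
  have "poly p (of_int q) \<in> \<int>"
    using assms by (auto simp: poly_altdef int_coeffs_def intro!: Ints_sum Ints_mult Ints_power)
  then show ?thesis using that by (auto elim: Ints_cases)
qed

lemma primitive_roots_nonempty:
  assumes "n > 0"
  shows "primitive_roots n \<noteq> {}"
proof -
  have "cis (2 * pi / n) ^ m \<noteq> 1" if "0 < m" "m < n" for m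
  proof -
    have "inj_on (\<lambda>k. cis (2 * pi * real k / real n)) {..<n}"
      using bij_betw_roots_unity[OF assms] by (rule bij_betw_imp_inj_on)
    from inj_onD[OF this, of m 0] that show ?thesis
      by (auto simp: DeMoivre mult_ac)
  qed
  moreover have "cis (2 * pi / n) ^ n = 1"
    using assms by (simp add: DeMoivre)
  ultimately show ?thesis by (auto simp: primitive_roots_def)
qed

text \<open>On the unit circle only 1 has real part 1, so the real part of \<open>q - z\<close>
  already exceeds \<open>q - 1\<close>.\<close>

lemma norm_diff_root_unity:
  assumes "z ^ n = 1" "n > 0" "z \<noteq> (1::complex)"
  shows "q - 1 < norm (of_real q - z)"
proof -
  have nz: "norm z = 1"
    using assms by (metis norm_one norm_power power_eq_1_iff norm_ge_zero less_numeral_extra(3))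
  have "Re z \<noteq> 1"
  proof
    assume "Re z = 1"
    with nz have "Im z = 0" by (simp add: cmod_def)
    with \<open>Re z = 1\<close> assms(3) show False by (simp add: complex_eq_iff)
  qed
  moreover have "Re z \<le> 1" using nz complex_Re_le_cmod[of z] by simp
  ultimately have "q - 1 < Re (of_real q - z)" by simp
  also have "\<dots> \<le> norm (of_real q - z)" by (rule complex_Re_le_cmod)
  finally show ?thesis .
qed

text \<open>\<open>P\<close> is the absolute value of the \<open>n\<close>-th cyclotomic polynomial
  at \<open>q\<close>. Divisibility holds because the \<open>d\<close>-th roots and the primitive
  \<open>n\<close>-th roots are disjoint sets of \<open>n\<close>-th roots. For the bound, each
  factor \<open>q - z\<close> has norm above \<open>q - 1\<close>, which is at least 1.\<close>

lemma cyclotomic_value: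
  fixes q :: int
  assumes q: "q \<ge> 2" and n: "n \<ge> 2"
  obtains P :: int where "P > q - 1" "P dvd q ^ n - 1"
    "\<And>d. d dvd n \<Longrightarrow> d < n \<Longrightarrow> (q ^ d - 1) * P dvd q ^ n - 1"
proof -
  let ?R = "\<lambda>d. {z::complex. z ^ d = 1}"
  have n0: "n > 0" using n by simp
  obtain k where k: "poly (root_poly (primitive_roots n)) (of_int q) = of_int k"
    using poly_int_coeffs[OF int_coeffs_primitive_roots[OF n0]] .
  have R: "poly (root_poly (?R d)) (of_int q) = of_int (q ^ d - 1)" if "d > 0" for d
    using that by (simp add: root_poly_roots_unity poly_monom)
  have div: "(q ^ d - 1) * k dvd q ^ n - 1" if d: "d dvd n" "d < n" for d
  proof -
    have d0: "d > 0" using d n0 by (auto intro: Nat.gr0I)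
    have disj: "?R d \<inter> primitive_roots n = {}"
      using d d0 by (auto simp: primitive_roots_def)
    have sub: "?R d \<union> primitive_roots n \<subseteq> ?R n"
      using d by (auto simp: primitive_roots_def power_mult elim!: dvdE)
    have fin: "finite (?R n)" "finite (?R d)" "finite (primitive_roots n)"
      using n0 d0 by (auto simp: finite_roots_unity finite_primitive_roots)
    have un: "root_poly (?R d \<union> primitive_roots n) = root_poly (?R d) * root_poly (primitive_roots n)"
      using fin disj by (simp add: root_poly_Un)
    let ?G = "root_poly (?R n - (?R d \<union> primitive_roots n))"
    have "int_coeffs ?G"
      using fin sub n0 d0 un
      by (intro int_coeffs_root_poly_Diff)
        (auto simp: int_coeffs_roots_unity int_coeffs_primitive_roots int_coeffs_mult)
    then obtain g where g: "poly ?G (of_int q) = of_int g" by (rule poly_int_coeffs)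
    have "root_poly (?R n) = root_poly (?R d) * root_poly (primitive_roots n) * ?G"
      using root_poly_Diff[OF fin(1) sub] un by simp
    then have "poly (root_poly (?R n)) (of_int q) =
        poly (root_poly (?R d)) (of_int q) * poly (root_poly (primitive_roots n)) (of_int q) * poly ?G (of_int q)"
      by (simp only: poly_mult)
    then have "(of_int (q ^ n - 1) :: complex) = of_int ((q ^ d - 1) * k * g)"
      using R[OF n0] R[OF d0] k g by (simp only: of_int_mult)
    then have "q ^ n - 1 = (q ^ d - 1) * k * g" by (simp only: of_int_eq_iff)
    then show ?thesis by simp
  qed
  have "k dvd q ^ n - 1"
    using div[of 1] n by (auto intro: dvd_trans[of k "(q - 1) * k"])
  have big: "real_of_int q - 1 < norm (of_int q - z)" if "z \<in> primitive_roots n" for z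
    using norm_diff_root_unity[of z n "of_int q"] that n
    by (fastforce simp: primitive_roots_def dest: spec[of _ 1])
  obtain z0 where z0: "z0 \<in> primitive_roots n" using primitive_roots_nonempty[OF n0] by blast
  have "real_of_int q - 1 < norm (of_int q - z0) * 1" using big[OF z0] by simp
  also have "\<dots> \<le> norm (of_int q - z0) * (\<Prod>z\<in>primitive_roots n - {z0}. norm (of_int q - z))"
    using big q by (intro mult_left_mono prod_ge_1) (fastforce, simp)
  also have "\<dots> = norm (poly (root_poly (primitive_roots n)) (of_int q))"
    using prod.remove[OF finite_primitive_roots[OF n0] z0, of "\<lambda>z. norm (of_int q - z)"]
    by (simp add: root_poly_def poly_prod prod_norm)
  also have "\<dots> = real_of_int \<bar>k\<bar>" by (simp add: k)
  finally have "q - 1 < \<bar>k\<bar>" by linarith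
  then show ?thesis using that[of "\<bar>k\<bar>"] div \<open>k dvd q ^ n - 1\<close> by (simp add: abs_if)
qed

subsection \<open>Witt's argument in a local ring with central maximal ideal\<close>

lemma card_eq_card_fibre_times_card_image:
  assumes "finite A" and "\<And>a. a \<in> A \<Longrightarrow> card {x \<in> A. f x = f a} = k"
  shows "card A = k * card (f ` A)"
proof -
  have "card A = (\<Sum>y\<in>f ` A. card {x \<in> A. f x = y})"
    using sum_fun_comp[of A "f ` A" f "\<lambda>_. 1::nat"] assms(1) by simp
  also have "\<dots> = (\<Sum>y\<in>f ` A. k)"
    using assms(2) by (intro sum.cong) auto
  finally show ?thesis by simp
qed

text \<open>The carrier is a subset of the type, with its own identity \<open>e\<close>, so that the
  locale can be interpreted again for the centre and for centralizers with the same \<open>N\<close>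
  and \<open>e\<close>. The ideal \<open>N\<close> is two-sided because it commutes with
  \<open>S\<close>.\<close>

locale local_subring =
  fixes S N :: "'a::{ring,finite} set" and e :: 'a
  assumes S_diff: "x \<in> S \<Longrightarrow> y \<in> S \<Longrightarrow> x - y \<in> S"
    and S_mult: "x \<in> S \<Longrightarrow> y \<in> S \<Longrightarrow> x * y \<in> S"
    and e_S: "e \<in> S"
    and e_left: "x \<in> S \<Longrightarrow> e * x = x"
    and e_right: "x \<in> S \<Longrightarrow> x * e = x"
    and N_S: "N \<subseteq> S"
    and zero_N: "0 \<in> N"
    and e_N: "e \<notin> N"
    and N_diff: "x \<in> N \<Longrightarrow> y \<in> N \<Longrightarrow> x - y \<in> N"
    and N_mult: "x \<in> S \<Longrightarrow> y \<in> N \<Longrightarrow> x * y \<in> N"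
    and N_central: "x \<in> S \<Longrightarrow> y \<in> N \<Longrightarrow> x * y = y * x"
    and unit_ex: "x \<in> S \<Longrightarrow> x \<notin> N \<Longrightarrow> \<exists>y\<in>S. x * y = e \<and> y * x = e"
begin

lemma zero_S: "0 \<in> S"
  using zero_N N_S by blast

lemma S_add: "x \<in> S \<Longrightarrow> y \<in> S \<Longrightarrow> x + y \<in> S"
  using S_diff[of x "0 - y"] S_diff[OF zero_S, of y] by simp

lemma N_add: "x \<in> N \<Longrightarrow> y \<in> N \<Longrightarrow> x + y \<in> N"
  using N_diff[of x "0 - y"] N_diff[OF zero_N, of y] by simp

lemma card_N_pos: "card N > 0"
  using zero_N by (auto simp: card_gt_0_iff)

text \<open>The order of the residue ring \<open>S / N\<close>; by \<open>card_S\<close> the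
  division is exact.\<close>

definition residue_card :: nat where
  "residue_card = card S div card N"

lemma card_S: "card S = residue_card * card N"
proof -
  let ?f = "\<lambda>c. (+) c ` N"
  have "card S = card N * card (?f ` S)"
  proof (rule card_eq_card_fibre_times_card_image)
    fix a assume a: "a \<in> S"
    have "(x \<in> S \<and> ?f x = ?f a) \<longleftrightarrow> x \<in> (+) a ` N" for x
    proof
      assume "x \<in> S \<and> ?f x = ?f a"
      moreover have "x \<in> ?f x" using zero_N by force
      ultimately show "x \<in> (+) a ` N" by blast
    next
      assume "x \<in> (+) a ` N"
      then obtain m where m: "m \<in> N" "x = a + m" by blast
      have "x + k \<in> ?f a" if "k \<in> N" for k
        using m that N_add by (auto simp: add.assoc)
      moreover have "a + k \<in> ?f x" if "k \<in> N" for k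
        using m that N_diff[of k m] by (intro image_eqI[of _ _ "k - m"]) auto
      ultimately show "x \<in> S \<and> ?f x = ?f a"
        using m a N_S S_add by blast
    qed
    then have "{x \<in> S. ?f x = ?f a} = (+) a ` N" by blast
    then show "card {x \<in> S. ?f x = ?f a} = card N"
      by (simp add: card_image)
  qed simp
  then show ?thesis using card_N_pos by (simp add: residue_card_def)
qed

lemma residue_card_ge_2: "residue_card \<ge> 2"
proof -
  have "card N < card S"
    using N_S e_S e_N by (intro psubset_card_mono) auto
  then have "1 * card N < residue_card * card N" using card_S by simp
  then have "1 < residue_card" by (simp only: mult_less_cancel2)
  then show ?thesis by simp
qed

section \<open>Modules over a local ring and Nakayama's lemma\<close>

text \<open>A unital left \<open>S\<close>-module inside the ambient ring. It may reach beyond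
  \<open>S\<close>, so that overrings of \<open>S\<close> count as modules.\<close>

definition submodule :: "'a set \<Rightarrow> bool" where
  "submodule W \<longleftrightarrow> 0 \<in> W \<and> (\<forall>x\<in>W. \<forall>y\<in>W. x - y \<in> W) \<and>
     (\<forall>x\<in>W. e * x = x) \<and> (\<forall>c\<in>S. \<forall>x\<in>W. c * x \<in> W)"

lemma submodule_extend:
  assumes W: "submodule W" and w: "e * w = w"
  shows "submodule ((\<lambda>(u, c). u + c * w) ` (W \<times> S))"
  unfolding submodule_def
proof (intro conjI ballI)
  let ?V = "(\<lambda>(u, c). u + c * w) ` (W \<times> S)"
  have V_I: "u + c * w \<in> ?V" if "u \<in> W" "c \<in> S" for u c
    using that by (intro image_eqI[of _ _ "(u, c)"]) auto
  show "0 \<in> ?V"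
    using V_I[of 0 0] W zero_S by (auto simp: submodule_def)
  fix x assume "x \<in> ?V"
  then obtain u c where x: "u \<in> W" "c \<in> S" "x = u + c * w" by auto
  show "e * x = x"
    using x W e_left by (auto simp: submodule_def distrib_left simp flip: mult.assoc)
  show "x - y \<in> ?V" if "y \<in> ?V" for y
  proof -
    from that obtain v d where y: "v \<in> W" "d \<in> S" "y = v + d * w" by auto
    then show ?thesis
      using V_I[of "u - v" "c - d"] x W S_diff by (auto simp: submodule_def algebra_simps)
  qed
  show "b * x \<in> ?V" if "b \<in> S" for b
    using V_I[of "b * u" "b * c"] x W S_mult that
    by (auto simp: submodule_def distrib_left mult.assoc)
qed

text \<open>A maximal proper submodule \<open>V\<close> of \<open>W\<close> contains \<open>N W\<close> by Nakayama's lemma, so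
  \<open>W / V\<close> is one-dimensional over the residue ring.\<close>

lemma submodule_step:
  assumes W: "submodule W" and nz: "W \<noteq> {0}"
  obtains V where "submodule V" "V \<subset> W" "card W = card V * residue_card"
proof -
  let ?F = "{V. submodule V \<and> V \<subset> W}"
  have "{0} \<in> ?F" using W nz by (auto simp: submodule_def)
  then obtain V where V: "submodule V" "V \<subset> W"
    and max: "\<And>V'. submodule V' \<Longrightarrow> V' \<subset> W \<Longrightarrow> V \<subseteq> V' \<Longrightarrow> V = V'"
    using finite_has_maximal[of ?F] by (metis (mono_tags, lifting) empty_iff finite mem_Collect_eq)
  have gen: "(\<lambda>(u, c). u + c * x) ` (V \<times> S) = W" if x: "x \<in> W" "x \<notin> V" for x
  proof -
    let ?V = "(\<lambda>(u, c). u + c * x) ` (V \<times> S)"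
    have ex: "e * x = x" using W x by (auto simp: submodule_def)
    have "submodule ?V" using V(1) ex by (rule submodule_extend)
    moreover have "V \<subseteq> ?V"
    proof
      fix u assume "u \<in> V"
      then show "u \<in> ?V" using zero_S by (intro image_eqI[of _ _ "(u, 0)"]) auto
    qed
    moreover have "x \<in> ?V"
      using V(1) ex e_S by (intro image_eqI[of _ _ "(0, e)"]) (auto simp: submodule_def)
    moreover have "?V \<subseteq> W"
    proof -
      have "u + c * x \<in> W" if "u \<in> V" "c \<in> S" for u c
      proof -
        have "u \<in> W" "0 - c * x \<in> W" using that V W x by (auto simp: submodule_def)
        then have "u - (0 - c * x) \<in> W" using W unfolding submodule_def by blast
        then show ?thesis by simp
      qed
      then show ?thesis by auto
    qed
    ultimately show ?thesis using max[of ?V] x by blast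
  qed
  obtain w where w: "w \<in> W" "w \<notin> V" using V by blast
  have ew: "e * w = w" using W w by (auto simp: submodule_def)
  \<comment> \<open>A unit \<open>c\<close> would carry \<open>c * w\<close> back to
    \<open>w\<close> inside \<open>V\<close>.\<close>
  have V_cancel: "c \<in> N" if c: "c \<in> S" "c * w \<in> V" for c
  proof (rule ccontr)
    assume "c \<notin> N"
    then obtain t where t: "t \<in> S" "t * c = e" using unit_ex c by blast
    then have "w = t * (c * w)" using ew by (simp flip: mult.assoc)
    moreover have "t * (c * w) \<in> V" using V(1) c t by (simp add: submodule_def)
    ultimately show False using w by simp
  qed
  \<comment> \<open>Nakayama: otherwise \<open>m * w\<close> generates \<open>W\<close> modulo
    \<open>V\<close>, so \<open>w = u + c * (m * w)\<close>. Then \<open>e - c * m\<close> sends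
    \<open>w\<close> into \<open>V\<close>, hence lies in \<open>N\<close>, and so does
    \<open>e\<close>.\<close>
  have N_w: "m * w \<in> V" if m: "m \<in> N" for m
  proof (rule ccontr)
    assume "m * w \<notin> V"
    moreover have "m * w \<in> W" using W w m N_S by (auto simp: submodule_def)
    ultimately have "w \<in> (\<lambda>(u, c). u + c * (m * w)) ` (V \<times> S)" using gen w by blast
    then obtain u c where uc: "u \<in> V" "c \<in> S" "w = u + c * (m * w)" by auto
    have cm: "c * m \<in> N" using uc m N_mult by blast
    have "(e - c * m) * w = u"
      using uc(3) ew by (simp add: left_diff_distrib mult.assoc) (metis add_diff_cancel_right')
    then have "e - c * m \<in> N"
      using uc cm N_S e_S S_diff by (intro V_cancel) auto
    then have "e - c * m + c * m \<in> N" using cm by (rule N_add)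
    then show False using e_N by simp
  qed
  \<comment> \<open>Each fibre of \<open>u + c * w\<close> is a copy of \<open>N\<close>: changing
    \<open>c\<close> by \<open>m\<close> in \<open>N\<close> is compensated by changing
    \<open>u\<close> by \<open>m * w\<close>, which lies in \<open>V\<close>.\<close>
  have "card (V \<times> S) = card N * card ((\<lambda>(u, c). u + c * w) ` (V \<times> S))"
  proof (rule card_eq_card_fibre_times_card_image)
    fix a assume "a \<in> V \<times> S"
    then obtain u c where a: "a = (u, c)" "u \<in> V" "c \<in> S" by auto
    let ?g = "\<lambda>m. (u - m * w, c + m)"
    have "{x \<in> V \<times> S. (case x of (u, c) \<Rightarrow> u + c * w) = (case a of (u, c) \<Rightarrow> u + c * w)} = ?g ` N"
    proof (intro equalityI subsetI)
      fix x assume "x \<in> {x \<in> V \<times> S. (case x of (u, c) \<Rightarrow> u + c * w) = (case a of (u, c) \<Rightarrow> u + c * w)}"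
      then obtain v d where x: "x = (v, d)" "v \<in> V" "d \<in> S" "v + d * w = u + c * w"
        using a by auto
      then have eq: "(d - c) * w = u - v" by (simp add: algebra_simps)
      then have "d - c \<in> N"
        using V(1) x a S_diff by (intro V_cancel) (auto simp: submodule_def)
      moreover have "x = ?g (d - c)" using x eq by simp
      ultimately show "x \<in> ?g ` N" by blast
    next
      fix x assume "x \<in> ?g ` N"
      then obtain m where "m \<in> N" "x = ?g m" by blast
      then show "x \<in> {x \<in> V \<times> S. (case x of (u, c) \<Rightarrow> u + c * w) = (case a of (u, c) \<Rightarrow> u + c * w)}"
        using a V(1) N_w N_S S_add by (auto simp: submodule_def algebra_simps)
    qed
    moreover have "inj_on ?g N" by (auto simp: inj_on_def)
    ultimately show "card {x \<in> V \<times> S. (case x of (u, c) \<Rightarrow> u + c * w) = (case a of (u, c) \<Rightarrow> u + c * w)} = card N"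
      by (simp add: card_image)
  qed simp
  then have "card V * residue_card * card N = card W * card N"
    using gen[OF w] card_S by (simp add: card_cartesian_product mult_ac)
  then have "card W = card V * residue_card" using card_N_pos by auto
  with V that show thesis by blast
qed

lemma card_submodule: "submodule W \<Longrightarrow> \<exists>k. card W = residue_card ^ k"
proof (induction "card W" arbitrary: W rule: less_induct)
  case less
  show ?case
  proof (cases "W = {0}")
    case True
    then have "card W = residue_card ^ 0" by simp
    then show ?thesis ..
  next
    case False
    then obtain V where V: "submodule V" "V \<subset> W" "card W = card V * residue_card"
      using submodule_step less.prems by blast
    have "card V < card W" using V by (intro psubset_card_mono) auto
    from less.hyps[OF this V(1)] obtain k where "card V = residue_card ^ k" ..
    with V have "card W = residue_card ^ Suc k" by simp
    then show ?thesis ..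
  qed
qed

lemma submodule_N: "submodule N"
  using zero_N N_diff N_mult N_S e_left by (auto simp: submodule_def)

text \<open>Through this lemma \<open>card_submodule\<close> measures \<open>S\<close> and the
  centralizers over the centre, and \<open>S\<close> over a centralizer.\<close>

lemma submodule_superring:
  assumes "local_subring T N e" "S \<subseteq> T"
  shows "submodule T"
proof -
  interpret T: local_subring T N e by fact
  show ?thesis using assms(2) T.zero_S T.S_diff T.S_mult T.e_left by (auto simp: submodule_def)
qed

section \<open>Centralizers, units and conjugacy classes\<close>

definition centralizer :: "'a set \<Rightarrow> 'a set" where
  "centralizer A = {c \<in> S. \<forall>a\<in>A. c * a = a * c}"

text \<open>Centralizers contain the central ideal \<open>N\<close> and are closed under inverses:
  \<open>y * a = y * (a * x) * y = (y * x) * a * y = a * y\<close>. The case \<open>A = S\<close>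
  gives the centre.\<close>

lemma centralizer_local_subring:
  assumes "A \<subseteq> S"
  shows "local_subring (centralizer A) N e"
proof
  show "x - y \<in> centralizer A" if "x \<in> centralizer A" "y \<in> centralizer A" for x y
    using that S_diff by (auto simp: centralizer_def algebra_simps)
  show "x * y \<in> centralizer A" if "x \<in> centralizer A" "y \<in> centralizer A" for x y
    using that S_mult unfolding centralizer_def by simp (metis mult.assoc)
  show "N \<subseteq> centralizer A"
    using assms N_S N_central by (fastforce simp: centralizer_def)
  show "e \<in> centralizer A"
    using assms e_S e_left e_right by (auto simp: centralizer_def subset_iff)
  show "\<exists>y\<in>centralizer A. x * y = e \<and> y * x = e" if x: "x \<in> centralizer A" "x \<notin> N" for x
  proof -
    obtain y where y: "y \<in> S" "x * y = e" "y * x = e"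
      using unit_ex x by (auto simp: centralizer_def)
    have "y * a = a * y" if "a \<in> A" for a
    proof -
      have a: "a \<in> S" "x * a = a * x" using assms that x by (auto simp: centralizer_def)
      have "y * a = y * (a * x) * y"
        using a y S_mult e_right by (simp add: mult.assoc)
      also have "\<dots> = (y * x) * a * y" using a by (simp add: mult.assoc)
      also have "\<dots> = a * y" using a y e_left by simp
      finally show ?thesis .
    qed
    then show ?thesis using y by (auto simp: centralizer_def)
  qed
qed (use e_left e_right zero_N e_N N_diff N_mult N_central in \<open>auto simp: centralizer_def\<close>)

definition inv :: "'a \<Rightarrow> 'a" where
  "inv x = (SOME y. y \<in> S \<and> x * y = e \<and> y * x = e)"

lemma inv:
  assumes "x \<in> S" "x \<notin> N"
  shows "inv x \<in> S" "x * inv x = e" "inv x * x = e"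
  using someI_ex[of "\<lambda>y. y \<in> S \<and> x * y = e \<and> y * x = e"] unit_ex[OF assms]
  by (auto simp: inv_def)

lemma inv_not_N: "x \<in> S \<Longrightarrow> x \<notin> N \<Longrightarrow> inv x \<notin> N"
  using N_mult[of x "inv x"] inv(2)[of x] e_N by auto

lemma unit_mult:
  assumes "x \<in> S" "x \<notin> N" "y \<in> S" "y \<notin> N"
  shows "x * y \<notin> N"
proof
  assume "x * y \<in> N"
  then have "inv x * (x * y) \<in> N" using inv assms N_mult by blast
  then show False using inv assms e_left by (simp flip: mult.assoc)
qed

lemma inv_mult_cancel:
  assumes "x \<in> S" "x \<notin> N" "y \<in> S"
  shows "inv x * (x * y) = y" "x * (inv x * y) = y" "y * inv x * x = y" "y * x * inv x = y"
  using inv[OF assms(1,2)] e_left[OF assms(3)] e_right[OF assms(3)] by (metis mult.assoc)+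

lemma conj_eq_iff:
  assumes "a \<in> S" "b \<in> S" "g \<in> S" "g \<notin> N"
  shows "g * a * inv g = b \<longleftrightarrow> g * a = b * g"
  using inv_mult_cancel(3,4)[of g] assms S_mult[of g a] by metis

text \<open>Orbit-stabilizer for the unit group \<open>S - N\<close>: the conjugators with the same
  value as \<open>g\<close> form the left coset of the units of \<open>centralizer {a}\<close> at
  \<open>g\<close>.\<close>

lemma card_conj_class:
  assumes a: "a \<in> S"
  shows "card (S - N) = card (centralizer {a} - N) * card ((\<lambda>g. g * a * inv g) ` (S - N))"
proof (rule card_eq_card_fibre_times_card_image)
  fix g assume "g \<in> S - N"
  then have g: "g \<in> S" "g \<notin> N" by auto
  have b: "g * a * inv g \<in> S" using g a inv(1) S_mult by simp
  have bg: "g * a * inv g * g = g * a" using inv_mult_cancel(3) g a S_mult by simp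
  have "{x \<in> S - N. x * a * inv x = g * a * inv g} = (*) g ` (centralizer {a} - N)"
  proof (intro equalityI subsetI)
    fix x assume "x \<in> {x \<in> S - N. x * a * inv x = g * a * inv g}"
    then have x: "x \<in> S" "x \<notin> N" "x * a = g * a * inv g * x"
      using conj_eq_iff a b by auto
    have "inv g * x * a = inv g * (g * (a * (inv g * x)))"
      using x by (simp add: mult.assoc)
    also have "\<dots> = a * (inv g * x)"
      using g a x inv S_mult by (intro inv_mult_cancel) auto
    finally have "inv g * x \<in> centralizer {a} - N"
      using g x inv inv_not_N unit_mult S_mult by (auto simp: centralizer_def)
    moreover have "x = g * (inv g * x)" using inv_mult_cancel g x by simp
    ultimately show "x \<in> (*) g ` (centralizer {a} - N)" by blast
  next
    fix x assume "x \<in> (*) g ` (centralizer {a} - N)"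
    then obtain c where c: "c \<in> S" "c \<notin> N" "c * a = a * c" "x = g * c"
      by (auto simp: centralizer_def)
    have x: "x \<in> S" "x \<notin> N" using c g S_mult unit_mult by auto
    have "x * a = g * a * inv g * x"
      using bg c by (simp flip: mult.assoc) (simp add: mult.assoc)
    then show "x \<in> {x \<in> S - N. x * a * inv x = g * a * inv g}"
      using conj_eq_iff[OF a b x] x by simp
  qed
  moreover have "inj_on ((*) g) (centralizer {a} - N)"
    using inv_mult_cancel(1) g by (intro inj_on_inverseI[of _ "(*) (inv g)"]) (auto simp: centralizer_def)
  ultimately show "card {x \<in> S - N. x * a * inv x = g * a * inv g} = card (centralizer {a} - N)"
    by (simp add: card_image)
qed simp

text \<open>The noncentral elements are partitioned into conjugacy classes under the units.
  Conjugacy is written \<open>g * a = b * g\<close> to keep inverses out of the relation.\<close>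

lemma dvd_card_noncentral:
  assumes "\<And>a. a \<in> S - centralizer S \<Longrightarrow> k dvd card ((\<lambda>g. g * a * inv g) ` (S - N))"
  shows "k dvd card (S - centralizer S)"
proof -
  let ?X = "S - centralizer S"
  define r where "r = {(a, b). a \<in> ?X \<and> b \<in> ?X \<and> (\<exists>g\<in>S - N. g * a = b * g)}"
  have "equiv ?X r"
  proof (rule equivI)
    show "refl_on ?X r"
      using e_S e_N e_left e_right by (auto simp: r_def refl_on_def intro!: bexI[of _ e])
    show "sym r"
    proof (rule symI)
      fix a b assume "(a, b) \<in> r"
      then obtain g where g: "a \<in> ?X" "b \<in> ?X" "g \<in> S" "g \<notin> N" "g * a = b * g"
        by (auto simp: r_def)
      have "inv g * b = inv g * (b * g) * inv g"
        using g inv inv_mult_cancel S_mult by (simp add: mult.assoc e_right)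
      also have "\<dots> = a * inv g"
        using g inv_mult_cancel by (simp flip: g(5))
      finally show "(b, a) \<in> r"
        using g inv inv_not_N by (auto simp: r_def intro!: bexI[of _ "inv g"])
    qed
    show "trans r"
    proof (rule transI)
      fix a b c assume "(a, b) \<in> r" "(b, c) \<in> r"
      then obtain g h where gh: "a \<in> ?X" "c \<in> ?X" "g \<in> S" "g \<notin> N" "g * a = b * g"
        "h \<in> S" "h \<notin> N" "h * b = c * h"
        by (auto simp: r_def)
      then have "h * g * a = c * (h * g)" by (metis mult.assoc)
      then show "(a, c) \<in> r"
        using gh S_mult unit_mult by (auto simp: r_def intro!: bexI[of _ "h * g"])
    qed
  qed (auto simp: r_def)
  moreover have "k dvd card X" if X: "X \<in> ?X // r" for X
  proof -
    obtain a where a: "a \<in> ?X" "X = r `` {a}" using X by (rule quotientE)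
    have "X = (\<lambda>g. g * a * inv g) ` (S - N)"
    proof (intro equalityI subsetI)
      fix b assume "b \<in> X"
      then obtain g where g: "b \<in> S" "g \<in> S" "g \<notin> N" "g * a = b * g"
        using a(2) by (auto simp: r_def)
      then have "b = g * a * inv g" using conj_eq_iff[of a b g] a(1) by simp
      then show "b \<in> (\<lambda>g. g * a * inv g) ` (S - N)" using g by blast
    next
      fix b assume "b \<in> (\<lambda>g. g * a * inv g) ` (S - N)"
      then obtain g where g: "g \<in> S" "g \<notin> N" "b = g * a * inv g" by blast
      then have b: "b \<in> S" "g * a = b * g"
        using a(1) inv(1) S_mult conj_eq_iff[of a b g] by auto
      have "b \<notin> centralizer S"
      proof
        assume "b \<in> centralizer S"
        then have "b * g = g * b" using g(1) by (auto simp: centralizer_def)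
        then have "g * a = g * b" using b(2) by (rule trans[rotated])
        then have "a = b" using inv_mult_cancel(1)[of g] g a(1) b by (metis DiffD1)
        then show False using a \<open>b \<in> centralizer S\<close> by simp
      qed
      then have "(a, b) \<in> r" unfolding r_def using a(1) b g(1,2) by blast
      then show "b \<in> X" using a(2) by simp
    qed
    then show ?thesis using assms a by simp
  qed
  ultimately show ?thesis by (intro equiv_imp_dvd_card[of ?X r k]) auto
qed

section \<open>Cardinalities and the class equation\<close>

text \<open>The residue ring of \<open>centralizer {a}\<close> has \<open>q ^ d\<close> elements.
  Both \<open>S\<close> and \<open>N\<close> are modules over that centralizer, so
  \<open>t + n\<close> and \<open>t\<close> are multiples of \<open>d\<close>, and hence so is
  \<open>n\<close>.\<close>

lemma residue_card_over_centralizer: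
  assumes a: "a \<in> S"
  defines "q \<equiv> local_subring.residue_card (centralizer S) N"
  assumes card_N: "card N = q ^ t" and card_S_eq: "card S = q ^ (t + n)"
  shows "\<exists>d. d dvd n \<and> card (centralizer {a}) = q ^ (t + d)"
proof -
  interpret Z: local_subring "centralizer S" N e by (rule centralizer_local_subring) simp
  interpret C: local_subring "centralizer {a}" N e using a by (intro centralizer_local_subring) simp
  have q2: "q \<ge> 2" using Z.residue_card_ge_2 by (simp add: q_def)
  have "centralizer S \<subseteq> centralizer {a}" using a by (auto simp: centralizer_def)
  then have "Z.submodule (centralizer {a})"
    by (intro Z.submodule_superring C.local_subring_axioms)
  then obtain c where c: "card (centralizer {a}) = q ^ c"
    using Z.card_submodule q_def by blast
  have "card N \<le> card (centralizer {a})" by (intro card_mono C.N_S) simp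
  then have "t \<le> c" using c card_N q2 by (simp add: power_increasing_iff)
  then obtain d where d: "c = t + d" using le_Suc_ex by blast
  have "C.residue_card * q ^ t = q ^ d * q ^ t"
    using C.card_S unfolding c d card_N power_add by (metis mult.commute)
  moreover have "q ^ t \<noteq> 0" using q2 by auto
  ultimately have \<kappa>: "C.residue_card = q ^ d" by (metis mult_cancel2)
  have "C.submodule S"
    by (intro C.submodule_superring local_subring_axioms) (auto simp: centralizer_def)
  then obtain i where "card S = (q ^ d) ^ i" using C.card_submodule \<kappa> by metis
  then have i: "t + n = d * i" using card_N card_S_eq q2 by (simp flip: power_mult)
  obtain j where "card N = (q ^ d) ^ j" using C.card_submodule C.submodule_N \<kappa> by metis
  then have "t = d * j" using card_N card_S_eq q2 by (simp flip: power_mult)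
  with i have "d dvd n" by (metis dvd_add_right_iff dvd_triv_left)
  then show ?thesis using c d by blast
qed

lemma commutative:
  assumes "x \<in> S" "y \<in> S"
  shows "x * y = y * x"
proof (rule ccontr)
  assume nc: "x * y \<noteq> y * x"
  let ?Z = "centralizer S"
  interpret Z: local_subring ?Z N e by (rule centralizer_local_subring) simp
  define q where "q = Z.residue_card"
  have q2: "q \<ge> 2" using Z.residue_card_ge_2 by (simp add: q_def)
  obtain t where t: "card N = q ^ t" using Z.card_submodule Z.submodule_N q_def by blast
  have "Z.submodule S"
    by (intro Z.submodule_superring local_subring_axioms) (auto simp: centralizer_def)
  then obtain r where r: "card S = q ^ r" using Z.card_submodule q_def by blast
  \<comment> \<open>The residue ring of the centre has \<open>q\<close> elements by the choice of
    \<open>q\<close>, which is the exponent 1 here.\<close>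
  have cZ: "card ?Z = q ^ (t + 1)" using Z.card_S t by (simp add: q_def)
  have "?Z \<subset> S" using nc assms by (auto simp: centralizer_def)
  then have "card ?Z < card S" by (intro psubset_card_mono) auto
  then have "t + 1 < r" using cZ r q2 by (simp only: power_strict_increasing_iff)
  then obtain n where n: "r = t + n" "n \<ge> 2" using that[of "r - t"] by simp
  have cS: "card S = q ^ (t + n)" using r n by simp
  have card_Diff_N: "int (card (T - N)) = int q ^ t * (int q ^ m - 1)"
    if "card T = q ^ (t + m)" "N \<subseteq> T" for T m
  proof -
    have "card T = card (T - N) + card N"
      using that card_Un_disjoint[of "T - N" N] by (auto simp: Un_absorb2)
    then have "int (card (T - N)) = int (card T) - int (card N)" by simp
    then show ?thesis using that t by (simp add: power_add right_diff_distrib)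
  qed
  obtain P where P: "P > int q - 1" "P dvd int q ^ n - 1"
    and P_d: "\<And>d. d dvd n \<Longrightarrow> d < n \<Longrightarrow> (int q ^ d - 1) * P dvd int q ^ n - 1"
    using cyclotomic_value[of "int q" n] q2 n by auto
  have "nat P dvd card ((\<lambda>g. g * a * inv g) ` (S - N))" if a: "a \<in> S - ?Z" for a
  proof -
    let ?k = "card ((\<lambda>g. g * a * inv g) ` (S - N))"
    interpret C: local_subring "centralizer {a}" N e using a by (intro centralizer_local_subring) simp
    obtain d where d: "d dvd n" "card (centralizer {a}) = q ^ (t + d)"
      using residue_card_over_centralizer[of a t n] a t cS q_def by auto
    obtain s where s: "s \<in> S" "a * s \<noteq> s * a" using a by (auto simp: centralizer_def)
    then have "s \<notin> centralizer {a}" by (auto simp: centralizer_def)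
    then have "centralizer {a} \<subset> S" using s(1) by (auto simp: centralizer_def)
    then have "card (centralizer {a}) < card S" by (intro psubset_card_mono) auto
    then have "t + d < t + n" using d cS q2 by (simp only: power_strict_increasing_iff)
    then have dn: "d < n" by simp
    have d0: "d > 0" using d n by (auto intro: Nat.gr0I)
    then have qd: "int q ^ d - 1 > 0" using q2 by simp
    have "int (card (S - N)) = int (card (centralizer {a} - N)) * int ?k"
      using card_conj_class[of a] a by simp
    then have "int q ^ t * (int q ^ n - 1) = int q ^ t * ((int q ^ d - 1) * int ?k)"
      using card_Diff_N[OF cS N_S] card_Diff_N[OF d(2) C.N_S] by simp
    \<comment> \<open>The class size is \<open>(q ^ n - 1) / (q ^ d - 1)\<close>; cancelling
      \<open>q ^ d - 1\<close> in \<open>P_d\<close> leaves \<open>P\<close> dividing it.\<close>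
    then have "int q ^ n - 1 = (int q ^ d - 1) * int ?k" using q2 by simp
    with P_d[OF d(1) dn] qd have "P dvd int ?k" by simp
    then show ?thesis using P q2 by (simp add: nat_dvd_iff)
  qed
  then have "nat P dvd card (S - ?Z)" by (rule dvd_card_noncentral)
  then have "P dvd int (card (S - ?Z))" using P q2 by (simp add: nat_dvd_iff)
  moreover have "int (card (S - ?Z)) = int q ^ t * ((int q ^ n - 1) - (int q - 1))"
  proof -
    have "card S = card (S - ?Z) + card ?Z"
      using \<open>?Z \<subset> S\<close> card_Un_disjoint[of "S - ?Z" ?Z] by (auto simp: Un_absorb2)
    then have "int (card (S - ?Z)) = int (card S) - int (card ?Z)" by simp
    then show ?thesis using cS cZ by (simp add: power_add algebra_simps)
  qed
  moreover have "coprime P (int q ^ t)"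
  proof -
    have "coprime (int q ^ n - 1) (int q ^ n)" by (rule coprime_diff_one_left)
    then have "coprime P (int q ^ n)" using P(2) by (rule coprime_divisors[OF _ dvd_refl, rotated])
    then show ?thesis using n by simp
  qed
  ultimately have "P dvd (int q ^ n - 1) - (int q - 1)"
    by (simp add: coprime_dvd_mult_right_iff)
  then have "P dvd int q - 1" using P(2) by (metis dvd_diff_right_iff dvd_diff_commute)
  then have "P \<le> int q - 1" using q2 by (intro zdvd_imp_le) auto
  with P(1) show False by simp
qed

end

subsection \<open>Rings with central nilpotents\<close>

lemma pos_power_Suc_0 [simp]: "pos_power x (Suc 0) = x"
  using pos_power_1 by simp

lemma pos_power_add:
  assumes "m \<ge> 1" "n \<ge> 1"
  shows "pos_power x m * pos_power x n = pos_power x (m + n)"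
  using assms(1)
proof (induction m rule: dec_induct)
  case base
  then show ?case using assms(2) by (simp add: pos_power_Suc del: One_nat_def) (simp add: pos_power_Suc)
next
  case (step m)
  then show ?case using assms(2) by (simp add: pos_power_Suc mult.assoc)
qed

text \<open>By pigeonhole the powers of \<open>x\<close> have period \<open>k\<close> from exponent
  \<open>a\<close> on. The exponent \<open>a * k\<close> is at least \<open>a\<close> and a multiple
  of \<open>k\<close>, so doubling it changes nothing.\<close>

lemma idempotent_power_ex:
  fixes x :: "'a::{semigroup_mult,finite}"
  shows "\<exists>m\<ge>1. pos_power x m * pos_power x m = pos_power x m"
proof -
  have "\<not> inj (\<lambda>i. pos_power x (Suc i))"
    using finite_UNIV_inj_surj infinite_UNIV_nat finite_imageD by (metis finite_class.finite_UNIV finite_subset subset_UNIV)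
  then obtain i j where "i \<noteq> j" "pos_power x (Suc i) = pos_power x (Suc j)"
    by (auto simp: inj_def)
  then obtain a k where k: "k \<ge> 1" "a \<ge> 1" "pos_power x (a + k) = pos_power x a"
  proof (cases i j rule: linorder_cases)
    case less
    then show ?thesis using that[of "j - i" "Suc i"] \<open>pos_power x (Suc i) = pos_power x (Suc j)\<close> by simp
  next
    case greater
    then show ?thesis using that[of "i - j" "Suc j"] \<open>pos_power x (Suc i) = pos_power x (Suc j)\<close> by simp
  qed simp
  have shift: "pos_power x (m + k) = pos_power x m" if "m \<ge> a" for m
    using that
  proof (induction m rule: dec_induct)
    case (step m)
    then show ?case using k by (simp add: pos_power_Suc)
  qed (use k in simp)
  have period: "pos_power x (a * k + t * k) = pos_power x (a * k)" for t
  proof (induction t)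
    case (Suc t)
    have "a \<le> a * k + t * k" using k by (simp add: trans_le_add1)
    from shift[OF this] Suc show ?case by (simp add: ac_simps)
  qed simp
  have "a * k \<ge> 1" using k by simp
  with period[of a] show ?thesis by (intro exI[of _ "a * k"]) (simp add: pos_power_add)
qed

lemma nilpotent_if_square_zero: "x * x = 0 \<Longrightarrow> nilpotent x"
  unfolding nilpotent_def by (intro exI[of _ 2]) (simp add: pos_power_def)

lemma pos_power_commutes:
  assumes "x * y = y * x" "n \<ge> 1"
  shows "pos_power x n * y = y * pos_power x n"
  using assms(2)
proof (induction n rule: dec_induct)
  case (step n)
  then show ?case using assms(1) by (simp add: pos_power_Suc) (metis mult.assoc)
qed (use assms(1) in simp)

lemma pos_power_mult_distrib:
  assumes "x * y = y * x" "n \<ge> 1"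
  shows "pos_power (x * y) n = pos_power x n * pos_power y n"
  using assms(2)
proof (induction n rule: dec_induct)
  case (step n)
  have "pos_power (x * y) (Suc n) = x * (y * pos_power x n) * pos_power y n"
    using step by (simp add: pos_power_Suc mult.assoc)
  also have "\<dots> = x * (pos_power x n * y) * pos_power y n"
    using pos_power_commutes[OF assms(1)] step by simp
  finally show ?case using step by (simp add: pos_power_Suc mult.assoc)
qed simp

lemma nilpotent_mult:
  assumes "nilpotent y" "x * y = y * x"
  shows "nilpotent (x * y)"
  using assms unfolding nilpotent_def by (metis pos_power_mult_distrib mult_zero_right)

lemma not_nilpotent_if_fixes:
  assumes "x * a = a" "a \<noteq> 0"
  shows "\<not> nilpotent x"
proof
  assume "nilpotent x"
  then obtain n where n: "n \<ge> 1" "pos_power x n = 0" by (auto simp: nilpotent_def)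
  have "pos_power x n * a = a"
    using n(1) by (induction n rule: dec_induct) (use assms in \<open>simp_all add: pos_power_Suc mult.assoc\<close>)
  with n assms show False by simp
qed

text \<open>The witness is the last nonzero power of \<open>x\<close>. For \<open>x = 0\<close>
  there is no such positive power, and \<open>e\<close> takes its place.\<close>

lemma nilpotent_annihilates:
  assumes "nilpotent x" "e * x = x" "e * e = e" "e \<noteq> 0"
  obtains a where "a \<noteq> 0" "x * a = 0" "e * a = a"
proof -
  define k where "k = (LEAST k. k \<ge> 1 \<and> pos_power x k = 0)"
  have k: "k \<ge> 1 \<and> pos_power x k = 0"
    using assms(1) unfolding k_def nilpotent_def by (rule LeastI_ex)
  have least: "pos_power x j \<noteq> 0" if "j \<ge> 1" "j < k" for j
    using not_less_Least[of j "\<lambda>k. k \<ge> 1 \<and> pos_power x k = 0"] that by (auto simp: k_def)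
  show thesis
  proof (cases "k = 1")
    case True
    then have "x = 0" using k by simp
    then show ?thesis using that[of e] assms by simp
  next
    case False
    then obtain j where j: "k = Suc j" "j \<ge> 1" using k by (cases k) auto
    have "e * pos_power x j = pos_power x j"
      using j(2) by (induction j rule: dec_induct) (use assms(2) in \<open>simp_all add: pos_power_Suc flip: mult.assoc\<close>)
    then show ?thesis using that[of "pos_power x j"] least j k pos_power_Suc[OF j(2), of x] by simp
  qed
qed

section \<open>Central idempotents and the minimal corner ring\<close>

context
  assumes nilpotent_central: "\<And>x::'a::{ring,finite}. nilpotent x \<Longrightarrow> x \<in> ring_center"
begin

lemma nilpotent_commutes: "nilpotent x \<Longrightarrow> x * y = y * (x::'a)"
  using nilpotent_central by (auto simp: ring_center_def)

text \<open>Both \<open>f * x - f * x * f\<close> and \<open>x * f - f * x * f\<close> square to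
  zero and so commute with \<open>f\<close>. Each is fixed by \<open>f\<close> on one side and
  killed on the other, hence is 0.\<close>

lemma idempotent_commutes:
  fixes f x :: 'a
  assumes ff: "f * f = f"
  shows "f * x = x * f"
proof -
  have ff': "f * (f * y) = f * y" for y using ff by (simp flip: mult.assoc)
  have "f * (f * x - f * x * f) = (f * x - f * x * f) * f"
    by (intro nilpotent_commutes[symmetric] nilpotent_if_square_zero)
      (simp add: algebra_simps ff ff')
  then have "f * x = f * x * f" by (simp add: algebra_simps ff ff')
  moreover have "f * (x * f - f * x * f) = (x * f - f * x * f) * f"
    by (intro nilpotent_commutes[symmetric] nilpotent_if_square_zero)
      (simp add: algebra_simps ff ff')
  then have "x * f = f * x * f" by (simp add: algebra_simps ff ff')
  ultimately show ?thesis by simp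
qed

text \<open>With \<open>f\<close> an idempotent power \<open>x^m\<close>, the \<open>m\<close>-th
  power of \<open>x - f * x\<close> is \<open>x^m - f * x^m = 0\<close>. So \<open>x - f * x\<close>
  is central, and its vanishing commutator with \<open>y\<close> is the claim.\<close>

lemma idempotent_fixes_commutator:
  fixes x y :: 'a
  obtains f where "f * f = f" "f * (x * y - y * x) = x * y - y * x"
proof -
  obtain m where m: "m \<ge> 1" "pos_power x m * pos_power x m = pos_power x m"
    using idempotent_power_ex by blast
  define f where "f = pos_power x m"
  have ff: "f * f = f" using m by (simp add: f_def)
  have ff': "f * (f * z) = f * z" for z using ff by (simp flip: mult.assoc)
  have fc: "z * f = f * z" for z using idempotent_commutes[OF ff] by simp
  have fc': "z * (f * w) = f * (z * w)" for z w using fc by (metis mult.assoc)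
  have "pos_power (x - f * x) n = pos_power x n - f * pos_power x n" if "n \<ge> 1" for n
    using that
  proof (induction n rule: dec_induct)
    case (step n)
    then have "pos_power (x - f * x) (Suc n) = (x - f * x) * (pos_power x n - f * pos_power x n)"
      by (simp add: pos_power_Suc)
    also have "\<dots> = pos_power x (Suc n) - f * pos_power x (Suc n)"
      using step(1) by (simp add: pos_power_Suc algebra_simps fc'[of x] ff')
    finally show ?case .
  qed simp
  from this[OF m(1)] have "pos_power (x - f * x) m = 0" using ff by (simp flip: f_def)
  then have "nilpotent (x - f * x)" using m(1) by (auto simp: nilpotent_def)
  then have "(x - f * x) * y = y * (x - f * x)" by (rule nilpotent_commutes)
  then have "f * (x * y - y * x) = x * y - y * x" by (simp add: algebra_simps fc'[of x] fc'[of y])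
  with ff show thesis by (rule that)
qed

text \<open>Minimality of \<open>e\<close> means that the ring \<open>e R\<close> has no idempotents besides \<open>0\<close> and \<open>e\<close>:
  an idempotent \<open>f\<close> splits it into the ideals of \<open>f\<close> and \<open>e - f\<close>, one of which still contains
  a nonzero multiple of \<open>c\<close>.\<close>

lemma corner_local_subring:
  fixes c e :: 'a
  assumes ee: "e * e = e" and ec: "e * c \<noteq> 0"
    and min: "\<And>f. f * f = f \<Longrightarrow> f * c \<noteq> 0 \<Longrightarrow> card {s. e * s = s} \<le> card {s. f * s = s}"
  shows "local_subring {s. e * s = s} {s. e * s = s \<and> nilpotent s} e"
proof -
  let ?S = "{s. e * s = s}"
  have e0: "e \<noteq> 0" using ec by auto
  have comm: "e * x = x * e" for x by (rule idempotent_commutes[OF ee])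
  have minimal: "f = e" if f: "f * f = f" "e * f = f" "f * c \<noteq> 0" for f
  proof -
    have "{s. f * s = s} \<subseteq> ?S" using f(2) by (auto, metis mult.assoc)
    then have "{s. f * s = s} = ?S" using min[OF f(1,3)] by (intro card_seteq) auto
    then have "f * e = e" using ee by blast
    then show ?thesis using f(2) comm[of f] by simp
  qed
  have power_S: "e * pos_power x n = pos_power x n" if "e * x = x" "n \<ge> 1" for x n
    using that(2) by (induction n rule: dec_induct) (use that(1) in \<open>simp_all add: pos_power_Suc flip: mult.assoc\<close>)
  have unit: "\<exists>y. e * y = y \<and> x * y = e \<and> y * x = e" if x: "e * x = x" "\<not> nilpotent x" for x
  proof -
    obtain m where m: "m \<ge> 1" "pos_power x m * pos_power x m = pos_power x m"
      using idempotent_power_ex by blast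
    define f where "f = pos_power x m"
    have f0: "f \<noteq> 0" using x(2) m(1) by (auto simp: nilpotent_def f_def)
    have ff: "f * f = f" using m by (simp add: f_def)
    have ef: "e * f = f" using power_S x m by (simp add: f_def)
    have fe: "f * e = f" using comm ef by simp
    \<comment> \<open>If \<open>f\<close> kills \<open>c\<close>, then \<open>e - f\<close> is an
      idempotent not killing \<open>c\<close>, and minimality would give \<open>e - f = e\<close>,
      contrary to \<open>f\<close> being nonzero.\<close>
    have "f = e"
    proof (cases "f * c = 0")
      case False
      then show ?thesis using minimal ff ef by blast
    next
      case True
      have "e - f = e"
        using ff ef fe ee ec True by (intro minimal) (simp_all add: algebra_simps)
      then show ?thesis using f0 by simp
    qed
    \<comment> \<open>The inverse comes from \<open>x^(2m) = e\<close> rather than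
      \<open>x^m = e\<close>, because \<open>m - 1\<close> may be 0 while \<open>2 * m - 1\<close>
      is always positive.\<close>
    let ?y = "pos_power x (2 * m - 1)"
    have "?y * x = pos_power x (2 * m)" "x * ?y = pos_power x (2 * m)"
      using m(1) pos_power_add[of "2 * m - 1" 1 x] pos_power_add[of 1 "2 * m - 1" x] by simp_all
    moreover have "pos_power x (2 * m) = e"
      using m pos_power_add[OF m(1) m(1), of x] \<open>f = e\<close> by (simp add: f_def mult_2)
    ultimately show ?thesis using power_S[OF x(1), of "2 * m - 1"] m(1) by (intro exI[of _ ?y]) simp
  qed
  show ?thesis
  proof
    show N_mult: "x * y \<in> {s. e * s = s \<and> nilpotent s}" if "x \<in> ?S" "y \<in> {s. e * s = s \<and> nilpotent s}" for x y
      using that nilpotent_mult[of y x] nilpotent_commutes[of y x] by (simp flip: mult.assoc)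
    show "x - y \<in> {s. e * s = s \<and> nilpotent s}"
      if "x \<in> {s. e * s = s \<and> nilpotent s}" "y \<in> {s. e * s = s \<and> nilpotent s}" for x y
    proof -
      have xy: "e * (x - y) = x - y" using that by (simp add: right_diff_distrib)
      have "nilpotent (x - y)"
      \<comment> \<open>If \<open>x - y\<close> had inverse \<open>t\<close>, then
        \<open>e - t * x = - t * y\<close> would be nilpotent, yet it fixes a nonzero
        \<open>a\<close> annihilated by the nilpotent \<open>t * x\<close>.\<close>
      proof (rule ccontr)
        assume "\<not> nilpotent (x - y)"
        then obtain t where t: "e * t = t" "t * (x - y) = e" using unit xy by blast
        have tx: "nilpotent (t * x)" "e * (t * x) = t * x"
          using N_mult[of t x] t that by auto
        have "nilpotent (- t * y)" using N_mult[of "- t" y] t that by simp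
        moreover have "- t * y = e - t * x" using t(2) by (simp add: algebra_simps)
        moreover obtain a where "a \<noteq> 0" "t * x * a = 0" "e * a = a"
          using nilpotent_annihilates[OF tx ee e0] .
        ultimately show False
          using not_nilpotent_if_fixes[of "e - t * x" a] by (simp add: left_diff_distrib)
      qed
      then show ?thesis using xy by simp
    qed
    show "e \<notin> {s. e * s = s \<and> nilpotent s}"
      using not_nilpotent_if_fixes[OF ee e0] by simp
    show "0 \<in> {s. e * s = s \<and> nilpotent s}"
      by (simp add: nilpotent_if_square_zero)
    show "x * e = x" if "x \<in> ?S" for x using that comm by simp
    show "x * y = y * x" if "y \<in> {s. e * s = s \<and> nilpotent s}" for x y
      using that nilpotent_commutes[of y x] by simp
  qed (use ee unit in \<open>auto simp: right_diff_distrib simp flip: mult.assoc\<close>)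
qed

lemma mult_commute_if_nilpotent_central:
  fixes x y :: 'a
  shows "x * y = y * x"
proof (rule ccontr)
  assume nc: "x * y \<noteq> y * x"
  let ?c = "x * y - y * x"
  obtain f where f: "f * f = f \<and> f * ?c \<noteq> 0"
    using idempotent_fixes_commutator[of x y] nc by (metis right_minus_eq)
  \<comment> \<open>Among the idempotents not killing the commutator, \<open>e\<close> has the
    smallest corner \<open>e R\<close>, written as the set of elements fixed by
    \<open>e\<close>.\<close>
  obtain e where e: "e * e = e" "e * ?c \<noteq> 0"
    and min: "\<And>f. f * f = f \<Longrightarrow> f * ?c \<noteq> 0 \<Longrightarrow> card {s. e * s = s} \<le> card {s. f * s = s}"
    using ex_has_least_nat[of "\<lambda>f. f * f = f \<and> f * ?c \<noteq> 0", OF f, of "\<lambda>f. card {s. f * s = s}"] by blast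
  interpret local_subring "{s. e * s = s}" "{s. e * s = s \<and> nilpotent s}" e
    using e min by (rule corner_local_subring)
  have "(e * x) * (e * y) = (e * y) * (e * x)"
    using e(1) by (intro commutative) (simp_all flip: mult.assoc)
  \<comment> \<open>Multiplication by the central idempotent \<open>e\<close> respects products, so
    commutativity of \<open>e R\<close> makes \<open>e\<close> kill the commutator.\<close>
  moreover have "(e * u) * (e * v) = e * (u * v)" for u v
    using e(1) idempotent_commutes[of e u] by (metis mult.assoc)
  ultimately show False using e(2) by (simp add: right_diff_distrib)
qed

end

theorem theorem1:
  assumes "\<forall>x::'a::{ring,finite}. nilpotent x \<longrightarrow> x \<in> ring_center"
  shows "\<forall>x y::'a. x * y = y * x"
  using mult_commute_if_nilpotent_central assms by blast

end
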